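(* Let $\mathcal{H}$ be an infinite-dimensional complex reproducing kernel Hilbert space of functions on a set $X$, with kernels $k_w$. Let $\mathbf{a}=\{a_1,\dots,a_n\}$ and $\mathbf{b}=\{b_1,\dots,b_n\}$ be disjoint subsets of $X$ with $n$ elements each, such that $\{k_{a_i},k_{b_j}:1\le i,j\le n\}$ is a linearly independent set of $2n$ functions and $\det\left((k_{b_i}(a_j))_{i,j=1}^n\right)\neq0$. Let $\mathcal{H}_0$, $\mathcal{Z}^0_{\mathbf{a}}$, $\mathcal{Z}^0_{\mathbf{b}}$ and $X_{\mathbf{ab}}$ be as defined in the context. Let $f\in\mathcal{Z}^0_{\mathbf{a}}$ with $\|f\|=1$. Then for $1\le j\le n$, $$\arcsin\left(\frac{|f(b_j)|}{k_{b_j}(b_j)^{1/2}}\right)\le\|X_{\mathbf{ab}}\|.$$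
   Context: The kernel $k_w\in\mathcal{H}$ satisfies $f(w)=\langle f,k_w\rangle$ for all $f\in\mathcal{H}$. $\mathcal{H}_0$ is the $2n$-dimensional span of $\{k_{a_i},k_{b_j}:1\le i,j\le n\}$; $\mathcal{Z}^0_{\mathbf{a}}=\mathcal{H}_0\ominus\langle k_{a_i}:1\le i\le n\rangle$ and $\mathcal{Z}^0_{\mathbf{b}}=\mathcal{H}_0\ominus\langle k_{b_j}:1\le j\le n\rangle$, i.e. the functions of $\mathcal{H}_0$ vanishing on $\mathbf{a}$, respectively $\mathbf{b}$. The subspaces $\mathcal{Z}^0_{\mathbf{a}},\mathcal{Z}^0_{\mathbf{b}}$ are in generic position in $\mathcal{H}_0$, and $X_{\mathbf{ab}}$ is the exponent of the unique minimal geodesic joining them: the unique self-adjoint operator on $\mathcal{H}_0$ with $\|X_{\mathbf{ab}}\|\le\pi/2$, $X_{\mathbf{ab}}\mathcal{Z}^0_{\mathbf{a}}\subset(\mathcal{Z}^0_{\mathbf{a}})^\perp$, $X_{\mathbf{ab}}(\mathcal{Z}^0_{\mathbf{a}})^\perp\subset\mathcal{Z}^0_{\mathbf{a}}$ and $e^{iX_{\mathbf{ab}}}\mathcal{Z}^0_{\mathbf{a}}=\mathcal{Z}^0_{\mathbf{b}}$ (equivalently, the exponent of the geodesic joining the orthogonal complements; orthogonal complements are taken in $\mathcal{H}_0$). *)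

theory Defs
  imports "HOL-Analysis.Analysis" "HOL-Library.Function_Algebras"
begin

definition cscale :: "complex \<Rightarrow> ('x \<Rightarrow> complex) \<Rightarrow> 'x \<Rightarrow> complex"
  where "cscale c f = (\<lambda>x. c * f x)"

global_interpretation cfun: vector_space "cscale :: complex \<Rightarrow> ('x \<Rightarrow> complex) \<Rightarrow> 'x \<Rightarrow> complex"
  by unfold_locales (auto simp: cscale_def fun_eq_iff algebra_simps)

definition hnorm :: "(('x \<Rightarrow> complex) \<Rightarrow> ('x \<Rightarrow> complex) \<Rightarrow> complex) \<Rightarrow> ('x \<Rightarrow> complex) \<Rightarrow> real"
  where "hnorm ip f = sqrt (Re (ip f f))"

text \<open>
  The underlying set of the function space is the type \<open>'x\<close>; the Hilbert space is a linear
  subspace \<open>H\<close> of all functions on it. The inner product \<open>ip\<close> is linear in the first argument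
  and constrained on \<open>H\<close> only; its values elsewhere are irrelevant.
\<close>

locale hilbert_function_space =
  fixes H :: "('x \<Rightarrow> complex) set"
    and ip :: "('x \<Rightarrow> complex) \<Rightarrow> ('x \<Rightarrow> complex) \<Rightarrow> complex"
  assumes subspace_H: "cfun.subspace H"
    and ip_add: "\<lbrakk>f \<in> H; g \<in> H; h \<in> H\<rbrakk> \<Longrightarrow> ip (f + g) h = ip f h + ip g h"
    and ip_scale: "\<lbrakk>f \<in> H; g \<in> H\<rbrakk> \<Longrightarrow> ip (cscale c f) g = c * ip f g"
    and ip_cnj: "\<lbrakk>f \<in> H; g \<in> H\<rbrakk> \<Longrightarrow> ip g f = cnj (ip f g)"
    and ip_pos: "\<lbrakk>f \<in> H; f \<noteq> 0\<rbrakk> \<Longrightarrow> 0 < Re (ip f f)"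
    and complete_H: "\<lbrakk>\<And>m. F m \<in> H; \<forall>e>0. \<exists>M. \<forall>m\<ge>M. \<forall>p\<ge>M. hnorm ip (F m - F p) < e\<rbrakk>
           \<Longrightarrow> \<exists>f\<in>H. (\<lambda>m. hnorm ip (F m - f)) \<longlonglongrightarrow> 0"

locale rkhs = hilbert_function_space H ip
  for H :: "('x \<Rightarrow> complex) set" and ip +
  fixes k :: "'x \<Rightarrow> 'x \<Rightarrow> complex"
  assumes kernel_in: "k w \<in> H"
    and reproducing: "f \<in> H \<Longrightarrow> f w = ip f (k w)"

definition infinite_dimensional :: "('x \<Rightarrow> complex) set \<Rightarrow> bool"
  where "infinite_dimensional V \<longleftrightarrow> (\<nexists>B. finite B \<and> V \<subseteq> cfun.span B)"

definition orth_in :: "(('x \<Rightarrow> complex) \<Rightarrow> ('x \<Rightarrow> complex) \<Rightarrow> complex) \<Rightarrow>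
    ('x \<Rightarrow> complex) set \<Rightarrow> ('x \<Rightarrow> complex) set \<Rightarrow> ('x \<Rightarrow> complex) set"
  where "orth_in ip V S = {f \<in> V. \<forall>g\<in>S. ip f g = 0}"

definition self_adjoint_on :: "(('x \<Rightarrow> complex) \<Rightarrow> ('x \<Rightarrow> complex) \<Rightarrow> complex) \<Rightarrow>
    ('x \<Rightarrow> complex) set \<Rightarrow> (('x \<Rightarrow> complex) \<Rightarrow> 'x \<Rightarrow> complex) \<Rightarrow> bool"
  where "self_adjoint_on ip V T \<longleftrightarrow>
    (\<forall>f\<in>V. T f \<in> V) \<and>
    (\<forall>f\<in>V. \<forall>g\<in>V. T (f + g) = T f + T g) \<and>
    (\<forall>c. \<forall>f\<in>V. T (cscale c f) = cscale c (T f)) \<and>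
    (\<forall>f\<in>V. \<forall>g\<in>V. ip (T f) g = ip f (T g))"

text \<open>
  The supremum is meaningful for bounded \<open>T\<close>, in particular for every linear \<open>T\<close> on a
  finite-dimensional \<open>V\<close>.
\<close>

definition opnorm_on :: "(('x \<Rightarrow> complex) \<Rightarrow> ('x \<Rightarrow> complex) \<Rightarrow> complex) \<Rightarrow>
    ('x \<Rightarrow> complex) set \<Rightarrow> (('x \<Rightarrow> complex) \<Rightarrow> 'x \<Rightarrow> complex) \<Rightarrow> real"
  where "opnorm_on ip V T = (SUP f\<in>{f \<in> V. hnorm ip f \<le> 1}. hnorm ip (T f))"

text \<open>The operator exponential: the sum of the exponential series, in the norm of \<open>H\<close>.\<close>

definition exp_op :: "('x \<Rightarrow> complex) set \<Rightarrow> (('x \<Rightarrow> complex) \<Rightarrow> ('x \<Rightarrow> complex) \<Rightarrow> complex) \<Rightarrow>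
    (('x \<Rightarrow> complex) \<Rightarrow> 'x \<Rightarrow> complex) \<Rightarrow> ('x \<Rightarrow> complex) \<Rightarrow> 'x \<Rightarrow> complex"
  where "exp_op H ip T f =
    (THE g. g \<in> H \<and> (\<lambda>m. hnorm ip ((\<Sum>i<m. cscale (1 / fact i) ((T ^^ i) f)) - g)) \<longlonglongrightarrow> 0)"

text \<open>
  \<open>T\<close> is the exponent of the minimal geodesic joining the subspaces \<open>Z\<close> and \<open>W\<close> of \<open>V\<close>. For
  subspaces in generic position such a \<open>T\<close> exists and its restriction to \<open>V\<close> is unique; the
  values of \<open>T\<close> outside \<open>V\<close> play no role.
\<close>

definition geodesic_exponent :: "('x \<Rightarrow> complex) set \<Rightarrow>
    (('x \<Rightarrow> complex) \<Rightarrow> ('x \<Rightarrow> complex) \<Rightarrow> complex) \<Rightarrow> ('x \<Rightarrow> complex) set \<Rightarrow>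
    ('x \<Rightarrow> complex) set \<Rightarrow> ('x \<Rightarrow> complex) set \<Rightarrow> (('x \<Rightarrow> complex) \<Rightarrow> 'x \<Rightarrow> complex) \<Rightarrow> bool"
  where "geodesic_exponent H ip V Z W T \<longleftrightarrow>
    self_adjoint_on ip V T \<and>
    opnorm_on ip V T \<le> pi / 2 \<and>
    T ` Z \<subseteq> orth_in ip V Z \<and>
    T ` orth_in ip V Z \<subseteq> Z \<and>
    exp_op H ip (\<lambda>f. cscale \<i> (T f)) ` Z = W"

definition kernel_span :: "('x \<Rightarrow> 'x \<Rightarrow> complex) \<Rightarrow> 'x set \<Rightarrow> ('x \<Rightarrow> complex) set"
  where "kernel_span k S = cfun.span (k ` S)"

end

theory Submission imports Defs begin

text \<open>
  With \<open>A = \<i> X\<close>, the curve \<open>e\<^sup>t\<^sup>A f\<close> runs on the unit sphere from \<open>f\<close> with speed at most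
  \<open>\<theta> = \<parallel>X\<parallel>\<close>. At time 1 it lies in the functions vanishing on \<open>b\<close>, hence it is orthogonal to the
  kernel at \<open>b\<^sub>j\<close>. So the angle between \<open>f\<close> and any unit multiple \<open>h\<close> of that kernel is at least
  \<open>\<pi>/2 - \<theta>\<close>, that is, \<open>arcsin (Re \<langle>f, h\<rangle>) \<le> \<theta>\<close>. In finite dimension the curve is obtained from its
  coordinates in an orthonormal basis, which are scalar power series.
\<close>

section \<open>Angular speed of a real function with values in [-1, 1]\<close>

text \<open>The speed bound says that \<open>arcsin \<circ> \<phi>\<close> has slope at most
  \<theta> wherever it is differentiable, so the mean value theorem on [0, 1] gives the claim away
  from the endpoints of arcsin; the rest follows by a limit.\<close>

lemma arcsin_diff_le:
  fixes \<phi> \<phi>' :: "real \<Rightarrow> real"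
  assumes deriv: "\<And>t. (\<phi> has_real_derivative \<phi>' t) (at t)"
    and speed: "\<And>t. \<bar>\<phi>' t\<bar> \<le> \<theta> * sqrt (1 - (\<phi> t)\<^sup>2)"
    and bound: "\<And>t. \<bar>\<phi> t\<bar> \<le> 1"
    and "\<theta> \<ge> 0"
  shows "\<bar>arcsin (\<phi> 1) - arcsin (\<phi> 0)\<bar> \<le> \<theta>"
proof -
  \<comment> \<open>Shrinking by \<open>r < 1\<close> keeps \<open>r \<phi>\<close> off \<open>\<plusminus>1\<close>, where arcsin is not differentiable.\<close>
  have *: "\<bar>arcsin (r * \<phi> 1) - arcsin (r * \<phi> 0)\<bar> \<le> \<theta>" if r: "0 < r" "r < 1" for r
  proof -
    have lt: "\<bar>r * \<phi> t\<bar> < 1" for t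
    proof -
      have "\<bar>r * \<phi> t\<bar> \<le> r * 1"
        unfolding abs_mult using r bound[of t] by (intro mult_mono) auto
      with r show ?thesis by simp
    qed
    have D: "((\<lambda>t. arcsin (r * \<phi> t)) has_real_derivative
        inverse (sqrt (1 - (r * \<phi> t)\<^sup>2)) * (r * \<phi>' t)) (at t)" for t
      using lt[of t] by (intro DERIV_chain2[OF DERIV_arcsin] DERIV_cmult deriv) auto
    obtain t where t: "arcsin (r * \<phi> 1) - arcsin (r * \<phi> 0) =
        (1 - 0) * (inverse (sqrt (1 - (r * \<phi> t)\<^sup>2)) * (r * \<phi>' t))"
      using MVT2[of 0 1 "\<lambda>t. arcsin (r * \<phi> t)", OF _ D] by auto
    have sq: "(r * \<phi> t)\<^sup>2 < 1" using lt[of t] by (simp add: abs_square_less_1)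
    have le: "(r * \<phi> t)\<^sup>2 \<le> (\<phi> t)\<^sup>2"
      unfolding power_mult_distrib using r by (simp add: mult_left_le_one_le power_le_one)
    have "\<bar>r * \<phi>' t\<bar> \<le> 1 * \<bar>\<phi>' t\<bar>"
      unfolding abs_mult using r by (intro mult_mono) auto
    also have "\<dots> \<le> \<theta> * sqrt (1 - (\<phi> t)\<^sup>2)" using speed[of t] by simp
    also have "\<dots> \<le> \<theta> * sqrt (1 - (r * \<phi> t)\<^sup>2)"
      using le \<open>\<theta> \<ge> 0\<close> by (intro mult_left_mono) auto
    finally have "\<bar>r * \<phi>' t\<bar> / sqrt (1 - (r * \<phi> t)\<^sup>2) \<le> \<theta>"
      using sq by (simp add: pos_divide_le_eq)
    moreover have "\<bar>arcsin (r * \<phi> 1) - arcsin (r * \<phi> 0)\<bar> = \<bar>r * \<phi>' t\<bar> / sqrt (1 - (r * \<phi> t)\<^sup>2)"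
      unfolding t using sq by (simp add: abs_mult divide_inverse del: power_mult_distrib)
    ultimately show ?thesis by simp
  qed
  \<comment> \<open>The factors increase to 1; the shift by 2 keeps them strictly between 0 and 1
    from n = 0 on. Unlike its derivative, arcsin is continuous up to the endpoints.\<close>
  have lim: "(\<lambda>n. arcsin ((1 - 1 / real (n + 2)) * \<phi> t)) \<longlonglongrightarrow> arcsin (\<phi> t)" for t
  proof (rule continuous_on_tendsto_compose[OF continuous_on_arcsin'])
    show "(\<lambda>n. (1 - 1 / real (n + 2)) * \<phi> t) \<longlonglongrightarrow> \<phi> t"
    proof -
      have "(\<lambda>n. 1 / real (n + 2)) \<longlonglongrightarrow> 0"
        using LIMSEQ_ignore_initial_segment[OF lim_1_over_n, of 2] by simp
      from tendsto_mult[OF tendsto_diff[OF tendsto_const[of 1] this] tendsto_const[of "\<phi> t"]]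
      show ?thesis by simp
    qed
    show "\<phi> t \<in> {-1..1}" using bound[of t] by auto
    have "\<bar>(1 - 1 / real (n + 2)) * \<phi> t\<bar> \<le> 1 * 1" for n
      unfolding abs_mult using bound[of t] by (intro mult_mono) (auto simp: field_simps)
    then show "\<forall>\<^sub>F n in sequentially. (1 - 1 / real (n + 2)) * \<phi> t \<in> {-1..1}"
      by (intro always_eventually) (auto simp: abs_le_iff)
  qed
  have "(\<lambda>n. \<bar>arcsin ((1 - 1 / real (n + 2)) * \<phi> 1) - arcsin ((1 - 1 / real (n + 2)) * \<phi> 0)\<bar>)
      \<longlonglongrightarrow> \<bar>arcsin (\<phi> 1) - arcsin (\<phi> 0)\<bar>"
    by (intro tendsto_rabs tendsto_diff lim)
  then show ?thesis
    by (rule tendsto_upperbound, intro always_eventually allI *) auto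
qed

lemma unimodular_rotation:
  obtains u :: complex where "cmod u = 1" "u * z = of_real (cmod z)"
proof (cases "z = 0")
  case True
  then show thesis using that[of 1] by simp
next
  case False
  then show thesis
    using that[of "cnj z / of_real (cmod z)"]
    by (simp add: norm_divide complex_norm_square[symmetric] mult.commute[of "cnj z"] power2_eq_square)
qed

section \<open>Inner product and norm on the carrier \<open>H\<close>\<close>

context hilbert_function_space
begin

lemma H_closed [simp, intro]:
  "0 \<in> H" "f \<in> H \<Longrightarrow> g \<in> H \<Longrightarrow> f + g \<in> H" "f \<in> H \<Longrightarrow> g \<in> H \<Longrightarrow> f - g \<in> H"
  "f \<in> H \<Longrightarrow> cscale c f \<in> H"
  using subspace_H cfun.subspace_0 cfun.subspace_add cfun.subspace_diff cfun.subspace_scale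
  by blast+

lemma H_sum [intro]: "(\<And>i. i \<in> I \<Longrightarrow> g i \<in> H) \<Longrightarrow> sum g I \<in> H"
  by (rule cfun.subspace_sum[OF subspace_H])

lemma ip_diff: "\<lbrakk>f \<in> H; g \<in> H; h \<in> H\<rbrakk> \<Longrightarrow> ip (f - g) h = ip f h - ip g h"
  using ip_add[of "f - g" g h] by simp

lemma ip_zero [simp]: "h \<in> H \<Longrightarrow> ip 0 h = 0"
  using ip_diff[of 0 0 h] by simp

lemma ip_zero_right [simp]: "h \<in> H \<Longrightarrow> ip h 0 = 0"
  using ip_cnj[of 0 h] by simp

lemma ip_sum: "\<lbrakk>\<And>i. i \<in> I \<Longrightarrow> g i \<in> H; h \<in> H\<rbrakk> \<Longrightarrow> ip (sum g I) h = (\<Sum>i\<in>I. ip (g i) h)"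
  by (induction I rule: infinite_finite_induct) (auto simp: ip_add H_sum)

lemma ip_add_right: "\<lbrakk>f \<in> H; g \<in> H; h \<in> H\<rbrakk> \<Longrightarrow> ip h (f + g) = ip h f + ip h g"
  by (simp add: ip_cnj[of "f + g" h] ip_cnj[of f h] ip_cnj[of g h] ip_add)

lemma ip_diff_right: "\<lbrakk>f \<in> H; g \<in> H; h \<in> H\<rbrakk> \<Longrightarrow> ip h (f - g) = ip h f - ip h g"
  using ip_add_right[of "f - g" g h] by simp

lemma ip_scale_right: "\<lbrakk>f \<in> H; g \<in> H\<rbrakk> \<Longrightarrow> ip f (cscale c g) = cnj c * ip f g"
  by (simp add: ip_cnj[of "cscale c g" f] ip_cnj[of g f] ip_scale)

lemma ip_self_nonneg: "f \<in> H \<Longrightarrow> 0 \<le> Re (ip f f)"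
  using ip_pos[of f] by (cases "f = 0") auto

lemma hnorm_nonneg [simp]: "f \<in> H \<Longrightarrow> 0 \<le> hnorm ip f"
  by (simp add: hnorm_def ip_self_nonneg)

lemma hnorm_square: "f \<in> H \<Longrightarrow> (hnorm ip f)\<^sup>2 = Re (ip f f)"
  by (simp add: hnorm_def ip_self_nonneg)

lemma ip_self: "f \<in> H \<Longrightarrow> ip f f = of_real ((hnorm ip f)\<^sup>2)"
  using ip_cnj[of f f] by (simp add: hnorm_square complex_eq_iff)

lemma hnorm_eq_0: "f \<in> H \<Longrightarrow> hnorm ip f = 0 \<longleftrightarrow> f = 0"
  using ip_pos[of f] by (cases "f = 0") (auto simp: hnorm_def)

lemma hnorm_scale: "f \<in> H \<Longrightarrow> hnorm ip (cscale c f) = cmod c * hnorm ip f"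
proof -
  assume f: "f \<in> H"
  have "ip (cscale c f) (cscale c f) = (c * cnj c) * ip f f"
    using f by (simp add: ip_scale ip_scale_right)
  also have "\<dots> = of_real ((cmod c * hnorm ip f)\<^sup>2)"
    using f by (simp add: ip_self complex_norm_square[symmetric] power_mult_distrib)
  finally show ?thesis
    using f unfolding hnorm_def[of ip "cscale c f"] by simp
qed

lemma abs_Re_ip_le:
  assumes "f \<in> H" "g \<in> H"
  shows "\<bar>Re (ip f g)\<bar> \<le> hnorm ip f * hnorm ip g"
proof (cases "g = 0")
  case True
  then show ?thesis using assms by (simp add: hnorm_eq_0)
next
  case False
  define s r where "s = (hnorm ip g)\<^sup>2" and "r = Re (ip f g)"
  have s: "s > 0" using False assms by (simp add: s_def hnorm_eq_0)
  have gf: "Re (ip g f) = r" using ip_cnj[of f g] assms by (simp add: r_def)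
  \<comment> \<open>Cauchy-Schwarz from the squared length of the remainder when \<open>f\<close> is
    projected onto the real line through \<open>g\<close>.\<close>
  have "0 \<le> Re (ip (f - cscale (of_real (r / s)) g) (f - cscale (of_real (r / s)) g))"
    using assms by (intro ip_self_nonneg) auto
  also have "\<dots> = (hnorm ip f)\<^sup>2 - r\<^sup>2 / s"
    using assms s gf
    by (simp add: ip_diff ip_diff_right ip_scale ip_scale_right ip_self[of f] ip_self[of g] s_def[symmetric]
        r_def[symmetric] field_simps power2_eq_square[of r])
  finally have "r\<^sup>2 \<le> (hnorm ip f * hnorm ip g)\<^sup>2"
    using s by (simp add: field_simps power_mult_distrib s_def[symmetric])
  then show ?thesis
    using assms unfolding r_def by (metis abs_le_square_iff abs_of_nonneg hnorm_nonneg mult_nonneg_nonneg)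
qed

text \<open>Rotating \<open>f\<close> by a unimodular factor makes the inner product real and
  nonnegative without changing the norm, which reduces the claim to the bound on real parts.\<close>

lemma norm_ip_le:
  assumes "f \<in> H" "g \<in> H"
  shows "cmod (ip f g) \<le> hnorm ip f * hnorm ip g"
proof -
  obtain u where u: "cmod u = 1" "u * ip f g = of_real (cmod (ip f g))"
    using unimodular_rotation .
  have "cmod (ip f g) = Re (ip (cscale u f) g)" using assms u by (simp add: ip_scale)
  also have "\<dots> \<le> hnorm ip (cscale u f) * hnorm ip g"
    using abs_Re_ip_le[of "cscale u f" g] assms by auto
  also have "\<dots> = hnorm ip f * hnorm ip g" using assms u by (simp add: hnorm_scale)
  finally show ?thesis .
qed

lemma hnorm_add_le:
  assumes "f \<in> H" "g \<in> H"
  shows "hnorm ip (f + g) \<le> hnorm ip f + hnorm ip g"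
proof (rule power2_le_imp_le)
  have "Re (ip g f) = Re (ip f g)" using ip_cnj[of f g] assms by simp
  then have "(hnorm ip (f + g))\<^sup>2 = (hnorm ip f)\<^sup>2 + (hnorm ip g)\<^sup>2 + 2 * Re (ip f g)"
    using assms by (simp add: hnorm_square ip_add ip_add_right)
  then show "(hnorm ip (f + g))\<^sup>2 \<le> (hnorm ip f + hnorm ip g)\<^sup>2"
    using abs_Re_ip_le[OF assms] by (simp add: power2_sum)
qed (use assms in auto)

text \<open>By the triangle inequality through \<open>s m\<close>. This is what makes the definite
  description in \<open>exp_op\<close> denote the limit.\<close>

lemma hnorm_limit_unique:
  assumes "g \<in> H" "g' \<in> H" "\<And>m. s m \<in> H"
    and "(\<lambda>m. hnorm ip (s m - g)) \<longlonglongrightarrow> 0" "(\<lambda>m. hnorm ip (s m - g')) \<longlonglongrightarrow> 0"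
  shows "g = g'"
proof -
  have "hnorm ip (g - g') \<le> hnorm ip (s m - g) + hnorm ip (s m - g')" for m
  proof -
    have "hnorm ip (g - s m) = hnorm ip (s m - g)"
      using hnorm_scale[of "s m - g" "-1"] assms(1-3) by simp
    then show ?thesis
      using hnorm_add_le[of "g - s m" "s m - g'"] assms(1-3) by simp
  qed
  moreover have "(\<lambda>m. hnorm ip (s m - g) + hnorm ip (s m - g')) \<longlonglongrightarrow> 0"
    using tendsto_add[OF assms(4,5)] by simp
  ultimately have "hnorm ip (g - g') \<le> 0"
    by (intro tendsto_lowerbound[of _ 0 sequentially]) auto
  moreover have "0 \<le> hnorm ip (g - g')" using assms(1,2) by simp
  ultimately have "hnorm ip (g - g') = 0" by linarith
  then show ?thesis using assms by (simp add: hnorm_eq_0)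
qed

section \<open>Orthonormal bases of finite-dimensional subspaces\<close>

definition orthonormal_basis :: "('x \<Rightarrow> complex) set \<Rightarrow> ('x \<Rightarrow> complex) set \<Rightarrow> bool"
  where "orthonormal_basis V E \<longleftrightarrow> finite E \<and> E \<subseteq> V \<and>
    (\<forall>d\<in>E. \<forall>e\<in>E. ip d e = (if d = e then 1 else 0)) \<and>
    (\<forall>v\<in>V. v = (\<Sum>e\<in>E. cscale (ip v e) e))"

lemma span_in_H: "B \<subseteq> H \<Longrightarrow> cfun.span B \<subseteq> H"
  by (rule cfun.span_minimal[OF _ subspace_H])

text \<open>Both sides of the expansion are linear in \<open>v\<close>. Hence it need only be
  checked on generators to hold on their span.\<close>

lemma subspace_expansion:
  assumes "E \<subseteq> H"
  shows "cfun.subspace {v \<in> H. v = (\<Sum>e\<in>E. cscale (ip v e) e)}"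
proof (rule cfun.subspaceI)
  show "0 \<in> {v \<in> H. v = (\<Sum>e\<in>E. cscale (ip v e) e)}"
    using assms by (auto simp: subset_iff cscale_def fun_eq_iff intro!: sum.neutral[symmetric])
next
  fix x y assume x: "x \<in> {v \<in> H. v = (\<Sum>e\<in>E. cscale (ip v e) e)}"
    and y: "y \<in> {v \<in> H. v = (\<Sum>e\<in>E. cscale (ip v e) e)}"
  have "(\<Sum>e\<in>E. cscale (ip (x + y) e) e) = (\<Sum>e\<in>E. cscale (ip x e) e + cscale (ip y e) e)"
    using x y assms by (intro sum.cong) (auto simp: ip_add cfun.scale_left_distrib subset_iff)
  also have "\<dots> = x + y" using x y by (simp add: sum.distrib)
  finally show "x + y \<in> {v \<in> H. v = (\<Sum>e\<in>E. cscale (ip v e) e)}" using x y by auto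
next
  fix c x assume x: "x \<in> {v \<in> H. v = (\<Sum>e\<in>E. cscale (ip v e) e)}"
  have "(\<Sum>e\<in>E. cscale (ip (cscale c x) e) e) = (\<Sum>e\<in>E. cscale c (cscale (ip x e) e))"
    using x assms by (intro sum.cong) (auto simp: ip_scale subset_iff)
  also have "\<dots> = cscale c (\<Sum>e\<in>E. cscale (ip x e) e)" by (simp only: cfun.scale_sum_right)
  also have "\<dots> = cscale c x" using x by simp
  finally show "cscale c x \<in> {v \<in> H. v = (\<Sum>e\<in>E. cscale (ip v e) e)}" using x by auto
qed

text \<open>Gram-Schmidt, by induction on the generators: \<open>p\<close> is the projection of the
  new vector \<open>b\<close> onto the span so far, and the remainder \<open>r\<close>, if nonzero,
  is normalised and adjoined.\<close>

lemma orthonormal_basis_exists: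
  assumes "finite B" "B \<subseteq> H"
  shows "\<exists>E. orthonormal_basis (cfun.span B) E"
  using assms
proof (induction B)
  case empty
  then show ?case by (auto simp: orthonormal_basis_def intro!: exI[of _ "{}"])
next
  case (insert b B)
  then obtain E where E: "orthonormal_basis (cfun.span B) E" by auto
  have EH: "E \<subseteq> H" and fin: "finite E" and EB: "E \<subseteq> cfun.span B"
    using E span_in_H[of B] insert.prems by (auto simp: orthonormal_basis_def)
  have on: "ip d e = (if d = e then 1 else 0)" if "d \<in> E" "e \<in> E" for d e
    using E that by (auto simp: orthonormal_basis_def)
  have bH: "b \<in> H" using insert by auto
  have mono: "cfun.span B \<subseteq> cfun.span (insert b B)" by (intro cfun.span_mono) auto
  define p where "p = (\<Sum>e\<in>E. cscale (ip b e) e)"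
  define r where "r = b - p"
  have pB: "p \<in> cfun.span B"
    unfolding p_def using EB by (auto intro!: cfun.span_sum cfun.span_scale)
  have pH: "p \<in> H" using pB span_in_H[of B] insert.prems by auto
  have rH: "r \<in> H" using bH pH by (simp add: r_def)
  have expand: "v = (\<Sum>e\<in>F. cscale (ip v e) e)"
    if v: "v \<in> cfun.span (insert b B)" and F: "F \<subseteq> H"
      and *: "\<And>v. v \<in> insert b B \<Longrightarrow> v = (\<Sum>e\<in>F. cscale (ip v e) e)" for v F
  proof -
    have "insert b B \<subseteq> {v \<in> H. v = (\<Sum>e\<in>F. cscale (ip v e) e)}"
      using * insert.prems by auto
    from cfun.span_minimal[OF this subspace_expansion[OF F]] v show ?thesis by blast
  qed
  have expB: "v = (\<Sum>e\<in>E. cscale (ip v e) e)" if "v \<in> cfun.span B" for v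
    using E that by (simp add: orthonormal_basis_def)
  show ?case
  proof (cases "r = 0")
    case True
    then have "b = p" by (simp add: r_def)
    have "v = (\<Sum>e\<in>E. cscale (ip v e) e)" if "v \<in> insert b B" for v
      using that expB[of v] pB \<open>b = p\<close> by (auto intro: cfun.span_base)
    then have "orthonormal_basis (cfun.span (insert b B)) E"
      unfolding orthonormal_basis_def
      using fin EB mono on expand[OF _ EH] by blast
    then show ?thesis by blast
  next
    case False
    define e0 where "e0 = cscale (1 / of_real (hnorm ip r)) r"
    have nr: "hnorm ip r > 0" using False hnorm_eq_0[OF rH] hnorm_nonneg[OF rH] by linarith
    have e0H: "e0 \<in> H" using rH by (simp add: e0_def)
    have ip_p: "ip p e = ip b e" if "e \<in> E" for e
    proof -
      have "ip p e = (\<Sum>d\<in>E. ip b d * ip d e)"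
        unfolding p_def using EH that
        by (subst ip_sum) (auto simp: ip_scale subset_iff)
      also have "\<dots> = (\<Sum>d\<in>E. if d = e then ip b d else 0)"
        by (intro sum.cong) (auto simp: on that)
      finally show ?thesis using fin that by simp
    qed
    have ip_r: "ip r e = 0" if "e \<in> E" for e
      using that EH bH pH by (auto simp: r_def ip_diff ip_p subset_iff)
    have ip_e0: "ip e0 e = 0" "ip e e0 = 0" if "e \<in> E" for e
    proof -
      show "ip e0 e = 0" using that ip_r EH rH by (auto simp: e0_def ip_scale subset_iff)
      then show "ip e e0 = 0" using that EH e0H ip_cnj[of e0 e] by (auto simp: subset_iff)
    qed
    have ip_Be0: "ip v e0 = 0" if "v \<in> cfun.span B" for v
    proof -
      have "ip v e0 = ip (\<Sum>e\<in>E. cscale (ip v e) e) e0" using expB[OF that] by simp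
      also have "\<dots> = 0"
        using EH e0H by (subst ip_sum) (auto simp: ip_scale subset_iff ip_e0)
      finally show ?thesis .
    qed
    have e00: "ip e0 e0 = 1"
    proof -
      have "hnorm ip e0 = 1" using rH nr by (simp add: e0_def hnorm_scale norm_divide)
      then show ?thesis using e0H by (simp add: ip_self)
    qed
    have "e0 \<notin> E" using ip_e0 e00 by force
    have r_eq: "r = cscale (of_real (hnorm ip r)) e0"
      using nr by (simp add: e0_def)
    have ip_be0: "ip b e0 = of_real (hnorm ip r)"
    proof -
      have "ip b e0 = ip p e0 + ip r e0"
        using ip_add[of p r e0] pH rH e0H by (simp add: r_def)
      also have "ip r e0 = of_real (hnorm ip r)"
        by (subst r_eq) (simp add: ip_scale e0H e00)
      finally show ?thesis using ip_Be0[OF pB] by simp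
    qed
    have e0span: "e0 \<in> cfun.span (insert b B)"
      unfolding e0_def r_def using pB mono
      by (intro cfun.span_scale cfun.span_diff) (auto intro: cfun.span_base)
    have exp: "v = (\<Sum>e\<in>insert e0 E. cscale (ip v e) e)" if "v \<in> insert b B" for v
    proof (cases "v = b")
      case True
      \<comment> \<open>The \<open>e0\<close> term of the expansion of \<open>b\<close> is the
        remainder \<open>r\<close>; the terms over \<open>E\<close> make up the projection
        \<open>p\<close>.\<close>
      have "(\<Sum>e\<in>insert e0 E. cscale (ip b e) e) = r + p"
        using fin \<open>e0 \<notin> E\<close> by (simp add: ip_be0 p_def[symmetric] r_eq[symmetric])
      then show ?thesis using True by (simp add: r_def)
    next
      case False
      then have v: "v \<in> cfun.span B" using that by (auto intro: cfun.span_base)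
      show ?thesis
        using fin \<open>e0 \<notin> E\<close> expB[OF v] ip_Be0[OF v] by simp
    qed
    have "orthonormal_basis (cfun.span (insert b B)) (insert e0 E)"
      unfolding orthonormal_basis_def
    proof (intro conjI ballI)
      show "v = (\<Sum>e\<in>insert e0 E. cscale (ip v e) e)" if "v \<in> cfun.span (insert b B)" for v
        using expand[OF that _ exp] EH e0H by blast
    qed (use fin EB mono e0span on ip_e0 e00 in auto)
    then show ?thesis by blast
  qed
qed

lemma parseval:
  assumes "orthonormal_basis V E" "V \<subseteq> H" "x \<in> V" "y \<in> H"
  shows "ip x y = (\<Sum>e\<in>E. ip x e * cnj (ip y e))"
proof -
  have E: "e \<in> H" if "e \<in> E" for e using that assms by (auto simp: orthonormal_basis_def)
  have "ip x y = ip (\<Sum>e\<in>E. cscale (ip x e) e) y"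
    using assms by (simp add: orthonormal_basis_def)
  also have "\<dots> = (\<Sum>e\<in>E. ip x e * ip e y)"
    using assms E by (subst ip_sum) (auto simp: ip_scale)
  also have "\<dots> = (\<Sum>e\<in>E. ip x e * cnj (ip y e))"
    using assms E by (intro sum.cong) (auto intro: ip_cnj)
  finally show ?thesis .
qed

section \<open>The operator norm as a bound\<close>

text \<open>A supremum over the reals bounds its members only if the set is bounded above. A crude
  bound from a finite orthonormal basis supplies this, and scaling to unit vectors does the
  rest.\<close>

lemma hnorm_le_opnorm:
  assumes T: "self_adjoint_on ip V T" and E: "orthonormal_basis V E"
    and V: "V \<subseteq> H" "cfun.subspace V" and v: "v \<in> V"
  shows "hnorm ip (T v) \<le> opnorm_on ip V T * hnorm ip v"
proof -
  have TV: "T x \<in> V" if "x \<in> V" for x using T that by (auto simp: self_adjoint_on_def)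
  have TH: "T x \<in> H" if "x \<in> V" for x using TV that V by blast
  have Tscale: "T (cscale c x) = cscale c (T x)" if "x \<in> V" for c x
    using T that by (auto simp: self_adjoint_on_def)
  have T_sym: "ip (T x) y = ip x (T y)" if "x \<in> V" "y \<in> V" for x y
    using T that by (auto simp: self_adjoint_on_def)
  have EV: "e \<in> V" if "e \<in> E" for e using E that by (auto simp: orthonormal_basis_def)
  have EH: "e \<in> H" if "e \<in> E" for e using EV that V by auto
  have on: "hnorm ip e = 1" if "e \<in> E" for e
    using E that by (auto simp: orthonormal_basis_def hnorm_def)
  have le: "hnorm ip (T x) \<le> (\<Sum>e\<in>E. hnorm ip (T e)) * hnorm ip x" if x: "x \<in> V" for x
  proof -
    have xH: "x \<in> H" using x V by auto
    have "ip (T x) (T x) = (\<Sum>e\<in>E. ip (T x) e * cnj (ip (T x) e))"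
      using parseval[OF E V(1) TV[OF x] TH[OF x]] .
    then have "(hnorm ip (T x))\<^sup>2 = (\<Sum>e\<in>E. (cmod (ip (T x) e))\<^sup>2)"
      using TH[OF x] by (simp add: hnorm_square complex_norm_square[symmetric])
    \<comment> \<open>One factor of each square is estimated directly, the other after moving
      \<open>T\<close> onto the basis vector by symmetry. This leaves a common factor
      \<open>hnorm ip (T x)\<close> that can be cancelled.\<close>
    also have "\<dots> \<le> (\<Sum>e\<in>E. (hnorm ip (T x) * hnorm ip e) * (hnorm ip x * hnorm ip (T e)))"
    proof (intro sum_mono)
      fix e assume e: "e \<in> E"
      show "(cmod (ip (T x) e))\<^sup>2 \<le> (hnorm ip (T x) * hnorm ip e) * (hnorm ip x * hnorm ip (T e))"
        unfolding power2_eq_square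
        using norm_ip_le[OF TH[OF x] EH[OF e]] norm_ip_le[OF xH TH[OF EV[OF e]]]
          T_sym[OF x EV[OF e]] TH[OF x] EH[OF e]
        by (intro mult_mono) auto
    qed
    also have "\<dots> = hnorm ip (T x) * ((\<Sum>e\<in>E. hnorm ip (T e)) * hnorm ip x)"
      using on by (simp add: sum_distrib_left sum_distrib_right mult_ac)
    finally have "hnorm ip (T x) * hnorm ip (T x)
        \<le> hnorm ip (T x) * ((\<Sum>e\<in>E. hnorm ip (T e)) * hnorm ip x)"
      by (simp add: power2_eq_square)
    moreover have "0 \<le> (\<Sum>e\<in>E. hnorm ip (T e)) * hnorm ip x"
      using TH EV xH by (intro mult_nonneg_nonneg sum_nonneg) auto
    ultimately show ?thesis
      using hnorm_nonneg[OF TH[OF x]] by (cases "hnorm ip (T x) = 0") auto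
  qed
  have bdd: "bdd_above ((\<lambda>x. hnorm ip (T x)) ` {x \<in> V. hnorm ip x \<le> 1})"
  proof (rule bdd_aboveI2)
    fix x assume "x \<in> {x \<in> V. hnorm ip x \<le> 1}"
    then have x: "x \<in> V" "hnorm ip x \<le> 1" by auto
    have "(\<Sum>e\<in>E. hnorm ip (T e)) * hnorm ip x \<le> (\<Sum>e\<in>E. hnorm ip (T e)) * 1"
      using x TH EV by (intro mult_left_mono sum_nonneg) auto
    then show "hnorm ip (T x) \<le> (\<Sum>e\<in>E. hnorm ip (T e))" using le[OF x(1)] by simp
  qed
  have vH: "v \<in> H" using v V by auto
  show ?thesis
  proof (cases "hnorm ip v = 0")
    case True
    then show ?thesis using le[OF v] by simp
  next
    case False
    then have nv: "hnorm ip v > 0" using hnorm_nonneg[OF vH] by linarith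
    define u where "u = cscale (of_real (1 / hnorm ip v)) v"
    have u: "u \<in> V" unfolding u_def by (rule cfun.subspace_scale[OF V(2) v])
    have "hnorm ip u = 1"
      unfolding u_def using nv by (simp add: hnorm_scale[OF vH] norm_divide)
    then have "hnorm ip (T u) \<le> opnorm_on ip V T"
      unfolding opnorm_on_def using u by (intro cSUP_upper[OF _ bdd]) auto
    moreover have "hnorm ip (T u) = hnorm ip (T v) / hnorm ip v"
      unfolding u_def Tscale[OF v] hnorm_scale[OF TH[OF v]] using nv
      by (simp add: norm_divide)
    ultimately show ?thesis using nv by (simp add: field_simps)
  qed
qed

section \<open>The exponential flow of a skew operator\<close>

text \<open>In the application \<open>V\<close> is \<open>H0\<close>, \<open>A\<close> is \<i> times
  the geodesic exponent and \<theta> is its operator norm. Skewness of \<open>A\<close> is then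
  self-adjointness of the exponent.\<close>

context
  fixes V E A and \<theta> :: real and f
  assumes V: "V \<subseteq> H" "cfun.subspace V"
    and E: "orthonormal_basis V E"
    and A_in: "\<And>x. x \<in> V \<Longrightarrow> A x \<in> V"
    and A_le: "\<And>x. x \<in> V \<Longrightarrow> hnorm ip (A x) \<le> \<theta> * hnorm ip x"
    and A_skew: "\<And>x y. x \<in> V \<Longrightarrow> y \<in> V \<Longrightarrow> ip (A x) y = - ip x (A y)"
    and f: "f \<in> V"
    and \<theta>: "\<theta> \<ge> 0"
begin

lemma V_in_H: "x \<in> V \<Longrightarrow> x \<in> H"
  using V by auto

lemma basis_in: "e \<in> E \<Longrightarrow> e \<in> V"
  using E by (auto simp: orthonormal_basis_def)

lemma iterate_in: "(A ^^ m) f \<in> V"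
  by (induction m) (auto intro: f A_in)

lemma hnorm_iterate_le: "hnorm ip ((A ^^ m) f) \<le> \<theta> ^ m * hnorm ip f"
proof (induction m)
  case (Suc m)
  have "hnorm ip (A ((A ^^ m) f)) \<le> \<theta> * (\<theta> ^ m * hnorm ip f)"
    using A_le[OF iterate_in, of m] mult_left_mono[OF Suc \<theta>] by linarith
  then show ?case by (simp add: mult_ac)
qed simp

text \<open>The value at \<open>z\<close> of the entire function \<open>\<langle>e\<^sup>z\<^sup>A f, h\<rangle>\<close>.\<close>

definition exp_coeff :: "('x \<Rightarrow> complex) \<Rightarrow> complex \<Rightarrow> complex"
  where "exp_coeff h z = (\<Sum>m. ip ((A ^^ m) f) h / fact m * z ^ m)"

text \<open>Since \<open>hnorm ip ((A ^^ m) f)\<close> grows at most like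
  \<open>\<theta> ^ m\<close>, the series is dominated by a multiple of the exponential series at
  \<theta> |z|.\<close>

lemma summable_exp_coeff:
  assumes h: "h \<in> V"
  shows "summable (\<lambda>m. ip ((A ^^ m) f) h / fact m * z ^ m)"
proof (rule summable_comparison_test')
  show "summable (\<lambda>m. hnorm ip f * hnorm ip h * (inverse (fact m) * (\<theta> * cmod z) ^ m))"
    by (intro summable_mult summable_exp)
  fix m
  have "cmod (ip ((A ^^ m) f) h) \<le> hnorm ip ((A ^^ m) f) * hnorm ip h"
    using norm_ip_le V_in_H iterate_in h by blast
  also have "\<dots> \<le> (\<theta> ^ m * hnorm ip f) * hnorm ip h"
    using hnorm_iterate_le V_in_H h by (intro mult_right_mono) auto
  finally have "cmod (ip ((A ^^ m) f) h) / fact m * cmod z ^ m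
      \<le> (\<theta> ^ m * hnorm ip f) * hnorm ip h / fact m * cmod z ^ m"
    by (intro mult_right_mono divide_right_mono) auto
  then show "norm (ip ((A ^^ m) f) h / fact m * z ^ m)
      \<le> hnorm ip f * hnorm ip h * (inverse (fact m) * (\<theta> * cmod z) ^ m)"
    by (simp add: norm_mult norm_divide norm_power power_mult_distrib field_simps)
qed

lemma exp_coeff_deriv:
  assumes h: "h \<in> V"
  shows "(exp_coeff h has_field_derivative - exp_coeff (A h) z) (at z)"
proof -
  have "(exp_coeff h has_field_derivative
      (\<Sum>m. diffs (\<lambda>m. ip ((A ^^ m) f) h / fact m) m * z ^ m)) (at z)"
    unfolding exp_coeff_def[abs_def]
    by (rule termdiffs_strong_converges_everywhere) (rule summable_exp_coeff[OF h])
  \<comment> \<open>Termwise differentiation shifts the index by one and cancels a factor of the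
    factorial; the extra application of \<open>A\<close> passes to \<open>h\<close> with a change of
    sign.\<close>
  also have "(\<lambda>m. diffs (\<lambda>m. ip ((A ^^ m) f) h / fact m) m * z ^ m)
      = (\<lambda>m. - (ip ((A ^^ m) f) (A h) / fact m * z ^ m))"
    using A_skew[OF iterate_in h]
    by (simp add: fun_eq_iff diffs_def fact_Suc field_simps del: of_nat_Suc)
  also have "(\<Sum>m. - (ip ((A ^^ m) f) (A h) / fact m * z ^ m)) = - exp_coeff (A h) z"
    unfolding exp_coeff_def by (rule suminf_minus) (rule summable_exp_coeff[OF A_in[OF h]])
  finally show ?thesis .
qed

text \<open>This is the curve \<open>e\<^sup>t\<^sup>A f\<close>, assembled from its coordinates, so
  that convergence and differentiation concern scalar series only.\<close>

definition flow :: "real \<Rightarrow> 'x \<Rightarrow> complex"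
  where "flow t = (\<Sum>e\<in>E. cscale (exp_coeff e (of_real t)) e)"

lemma flow_in: "flow t \<in> V"
  unfolding flow_def using V(2) basis_in
  by (intro cfun.subspace_sum cfun.subspace_scale) auto

text \<open>The coordinates determine every other inner product: the finite sum over the basis is
  exchanged with the series, and Parseval is applied to each iterate.\<close>

lemma ip_flow:
  assumes h: "h \<in> V"
  shows "ip (flow t) h = exp_coeff h (of_real t)"
proof -
  have "ip (flow t) h = (\<Sum>e\<in>E. exp_coeff e (of_real t) * ip e h)"
    unfolding flow_def using V_in_H basis_in h
    by (subst ip_sum) (auto simp: ip_scale)
  also have "\<dots> = (\<Sum>e\<in>E. \<Sum>m. ip ((A ^^ m) f) e / fact m * of_real t ^ m * ip e h)"
    unfolding exp_coeff_def using basis_in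
    by (intro sum.cong suminf_mult2 summable_exp_coeff) auto
  also have "\<dots> = (\<Sum>m. \<Sum>e\<in>E. ip ((A ^^ m) f) e / fact m * of_real t ^ m * ip e h)"
    using basis_in by (intro suminf_sum[symmetric] summable_mult2 summable_exp_coeff) auto
  also have "\<dots> = exp_coeff h (of_real t)"
    unfolding exp_coeff_def
  proof (intro suminf_cong)
    fix m
    have "ip ((A ^^ m) f) h = (\<Sum>e\<in>E. ip ((A ^^ m) f) e * cnj (ip h e))"
      using parseval[OF E V(1) iterate_in V_in_H[OF h]] .
    also have "\<dots> = (\<Sum>e\<in>E. ip ((A ^^ m) f) e * ip e h)"
      using V_in_H h basis_in by (intro sum.cong) (auto simp: ip_cnj[of h])
    finally show "(\<Sum>e\<in>E. ip ((A ^^ m) f) e / fact m * of_real t ^ m * ip e h)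
        = ip ((A ^^ m) f) h / fact m * of_real t ^ m"
      by (simp add: sum_distrib_right sum_distrib_left sum_divide_distrib mult_ac)
  qed
  finally show ?thesis .
qed

lemma flow_0: "flow 0 = f"
proof -
  have "exp_coeff e 0 = ip f e" for e
    unfolding exp_coeff_def using powser_zero[of "\<lambda>m. ip ((A ^^ m) f) e / fact m"] by simp
  then show ?thesis using E f by (simp add: flow_def orthonormal_basis_def)
qed

lemma flow_deriv:
  assumes h: "h \<in> V"
  shows "((\<lambda>t. ip (flow t) h) has_vector_derivative ip (A (flow t)) h) (at t)"
proof -
  have "((\<lambda>t. exp_coeff h (of_real t)) has_vector_derivative - exp_coeff (A h) (of_real t)) (at t)"
    by (rule has_vector_derivative_real_field) (rule exp_coeff_deriv[OF h])
  then show ?thesis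
    by (simp add: ip_flow[OF h] ip_flow[OF A_in[OF h]] A_skew[OF flow_in h])
qed

text \<open>The exponential of a skew operator is an isometry: the derivative of the squared norm is
  \<open>ip x (A x) + ip (A x) x\<close> at \<open>x = flow t\<close>, up to the order of the terms,
  and this vanishes.\<close>

lemma hnorm_flow: "hnorm ip (flow t) = hnorm ip f"
proof -
  have "((\<lambda>t. ip (flow t) (flow t)) has_vector_derivative 0) (at t)" for t
  proof -
    \<comment> \<open>Parseval turns the squared norm into a finite sum of products of scalar
      functions, to which the product rule applies.\<close>
    have "((\<lambda>t. \<Sum>e\<in>E. ip (flow t) e * cnj (ip (flow t) e)) has_vector_derivative
        (\<Sum>e\<in>E. ip (flow t) e * cnj (ip (A (flow t)) e) + ip (A (flow t)) e * cnj (ip (flow t) e)))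
        (at t)"
      using flow_deriv basis_in
      by (intro has_vector_derivative_sum has_vector_derivative_mult has_vector_derivative_cnj) auto
    moreover have "(\<Sum>e\<in>E. ip (flow t) e * cnj (ip (A (flow t)) e)
        + ip (A (flow t)) e * cnj (ip (flow t) e)) = 0"
      using A_skew[OF flow_in[of t] flow_in[of t]] flow_in A_in V_in_H
      by (simp add: sum.distrib flip: parseval[OF E V(1)])
    ultimately show ?thesis
      using flow_in V_in_H by (simp flip: parseval[OF E V(1)])
  qed
  then have "\<exists>c. \<forall>t. ip (flow t) (flow t) = c"
    using has_vector_derivative_zero_constant[of UNIV "\<lambda>t. ip (flow t) (flow t)"]
    by (metis UNIV_I convex_UNIV)
  then have "ip (flow t) (flow t) = ip (flow 0) (flow 0)" by metis
  then show ?thesis by (simp add: flow_0 hnorm_def)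
qed

text \<open>The partial sums of the exponential series converge to \<open>flow 1\<close> in every
  coordinate, hence in norm because the basis is finite; uniqueness of limits identifies the
  value.\<close>

lemma exp_op_eq_flow: "exp_op H ip A f = flow 1"
proof -
  define s where "s m = (\<Sum>i<m. cscale (1 / fact i) ((A ^^ i) f))" for m
  have sV: "s m \<in> V" for m
    unfolding s_def using V(2) iterate_in by (intro cfun.subspace_sum cfun.subspace_scale) auto
  have sH: "s m \<in> H" for m using sV V_in_H by auto
  have lim: "(\<lambda>m. ip (s m - flow 1) e) \<longlonglongrightarrow> 0" if e: "e \<in> V" for e
  proof -
    have "ip (s m) e = (\<Sum>i<m. ip ((A ^^ i) f) e / fact i * 1 ^ i)" for m
      unfolding s_def using V_in_H iterate_in e
      by (subst ip_sum) (auto simp: ip_scale)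
    moreover have "(\<lambda>m. \<Sum>i<m. ip ((A ^^ i) f) e / fact i * 1 ^ i) \<longlonglongrightarrow> exp_coeff e 1"
      unfolding exp_coeff_def by (rule summable_LIMSEQ[OF summable_exp_coeff[OF e]])
    ultimately have "(\<lambda>m. ip (s m) e) \<longlonglongrightarrow> ip (flow 1) e"
      by (simp add: ip_flow[OF e])
    from tendsto_diff[OF this tendsto_const[of "ip (flow 1) e"]] show ?thesis
      using sH flow_in V_in_H e by (simp add: ip_diff)
  qed
  have conv: "(\<lambda>m. hnorm ip (s m - flow 1)) \<longlonglongrightarrow> 0"
  proof -
    have "hnorm ip (s m - flow 1)
        = sqrt (Re (\<Sum>e\<in>E. ip (s m - flow 1) e * cnj (ip (s m - flow 1) e)))" for m
    proof -
      have "s m - flow 1 \<in> V" using cfun.subspace_diff[OF V(2) sV flow_in] .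
      then show ?thesis
        unfolding hnorm_def using V_in_H by (simp flip: parseval[OF E V(1)])
    qed
    moreover have "(\<lambda>m. sqrt (Re (\<Sum>e\<in>E. ip (s m - flow 1) e * cnj (ip (s m - flow 1) e))))
        \<longlonglongrightarrow> sqrt (Re (\<Sum>e\<in>E. 0 * cnj 0))"
      using lim basis_in by (intro tendsto_intros) auto
    ultimately show ?thesis by simp
  qed
  show ?thesis
    unfolding exp_op_def s_def[symmetric]
    using conv hnorm_limit_unique[OF _ _ sH _ conv] flow_in V_in_H
    by (intro the_equality) auto
qed

text \<open>The real cosine \<phi> of the angle between the curve and \<open>h\<close> runs from
  \<open>Re (ip f h)\<close> at time 0 to 0 at time 1, and its angular speed is at most
  \<theta>.\<close>

lemma arcsin_le_of_exp_orthogonal: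
  assumes nf: "hnorm ip f = 1" and h: "h \<in> V" and nh: "hnorm ip h = 1"
    and orth: "ip (exp_op H ip A f) h = 0"
  shows "arcsin (Re (ip f h)) \<le> \<theta>"
proof -
  define \<phi> where "\<phi> t = Re (ip (flow t) h)" for t
  have flowH: "flow t \<in> H" "A (flow t) \<in> H" for t using flow_in A_in V_in_H by auto
  have hH: "h \<in> H" using h V_in_H by auto
  have n1: "hnorm ip (flow t) = 1" for t using hnorm_flow nf by simp
  have deriv: "(\<phi> has_real_derivative Re (ip (A (flow t)) h)) (at t)" for t
    unfolding \<phi>_def has_real_derivative_iff_has_vector_derivative
    using bounded_linear.has_vector_derivative[OF bounded_linear_Re flow_deriv[OF h]] .
  have bound: "\<bar>\<phi> t\<bar> \<le> 1" for t
    using abs_Re_ip_le[OF flowH(1) hH] by (simp add: \<phi>_def n1 nh)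
  have speed: "\<bar>Re (ip (A (flow t)) h)\<bar> \<le> \<theta> * sqrt (1 - (\<phi> t)\<^sup>2)" for t
  proof -
    \<comment> \<open>The velocity is orthogonal to the curve in the real inner product, so only the component
      of \<open>h\<close> orthogonal to the curve contributes.\<close>
    define w where "w = h - cscale (of_real (\<phi> t)) (flow t)"
    have wH: "w \<in> H" using hH flowH by (simp add: w_def)
    \<comment> \<open>Skewness makes this inner product equal to minus its own conjugate, hence
      purely imaginary.\<close>
    have "Re (ip (A (flow t)) (flow t)) = 0"
      using A_skew[OF flow_in flow_in, of t t] ip_cnj[OF flowH(1) flowH(2), of t t]
      by (simp add: complex_eq_iff)
    then have "Re (ip (A (flow t)) h) = Re (ip (A (flow t)) w)"
      using hH flowH by (simp add: w_def ip_diff_right ip_scale_right)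
    moreover have "hnorm ip w = sqrt (1 - (\<phi> t)\<^sup>2)"
    proof -
      have "Re (ip h (flow t)) = \<phi> t" using ip_cnj[OF flowH(1) hH] by (simp add: \<phi>_def)
      moreover have "Re (ip h h) = 1" "Re (ip (flow t) (flow t)) = 1"
        using hnorm_square[OF hH] hnorm_square[OF flowH(1)] n1 nh by auto
      ultimately have "Re (ip w w) = 1 - (\<phi> t)\<^sup>2"
        unfolding w_def using hH flowH
        by (simp add: ip_diff ip_diff_right ip_scale ip_scale_right \<phi>_def[symmetric]
            power2_eq_square algebra_simps)
      then show ?thesis by (simp add: hnorm_def)
    qed
    moreover have "hnorm ip (A (flow t)) \<le> \<theta>" using A_le[OF flow_in, of t] n1 by simp
    ultimately show ?thesis
      using abs_Re_ip_le[OF flowH(2) wH, of t] mult_right_mono[OF _ hnorm_nonneg[OF wH]] by fastforce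
  qed
  have "\<phi> 1 = 0" using orth by (simp add: \<phi>_def exp_op_eq_flow)
  moreover have "\<phi> 0 = Re (ip f h)" by (simp add: \<phi>_def flow_0)
  ultimately show ?thesis
    using arcsin_diff_le[OF deriv speed bound \<theta>] by auto
qed

end

end

section \<open>Application to the kernel at a point of \<open>b\<close>\<close>

theorem corollary4p3:
  fixes H :: "('x \<Rightarrow> complex) set"
    and ip :: "('x \<Rightarrow> complex) \<Rightarrow> ('x \<Rightarrow> complex) \<Rightarrow> complex"
    and k :: "'x \<Rightarrow> 'x \<Rightarrow> complex"
    and a b :: "'n::finite \<Rightarrow> 'x"
    and H0 Za Zb :: "('x \<Rightarrow> complex) set"
    and Xab :: "('x \<Rightarrow> complex) \<Rightarrow> 'x \<Rightarrow> complex"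
    and f :: "'x \<Rightarrow> complex"
  assumes "rkhs H ip k"
    and "infinite_dimensional H"
    and "inj a" and "inj b" and "range a \<inter> range b = {}"
    and "cfun.independent (k ` (range a \<union> range b))"
    and "card (k ` (range a \<union> range b)) = 2 * CARD('n)"
    and "det ((\<chi> i j. k (b i) (a j)) :: complex ^ 'n ^ 'n) \<noteq> 0"
    and "H0 = kernel_span k (range a \<union> range b)"
    and "Za = orth_in ip H0 (kernel_span k (range a))"
    and "Zb = orth_in ip H0 (kernel_span k (range b))"
    and "geodesic_exponent H ip H0 Za Zb Xab"
    and "f \<in> Za" and "hnorm ip f = 1"
  shows "\<forall>j. arcsin (cmod (f (b j)) / sqrt (Re (k (b j) (b j)))) \<le> opnorm_on ip H0 Xab"
proof
  fix j
  interpret rkhs H ip k by fact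
  let ?A = "\<lambda>f. cscale \<i> (Xab f)"
  have T: "self_adjoint_on ip H0 Xab" and exp: "exp_op H ip ?A ` Za = Zb"
    using \<open>geodesic_exponent H ip H0 Za Zb Xab\<close> by (auto simp: geodesic_exponent_def)
  have sub: "cfun.subspace H0" by (simp add: assms(9) kernel_span_def)
  have H0: "H0 \<subseteq> H"
    unfolding assms(9) kernel_span_def by (intro span_in_H) (auto intro: kernel_in)
  obtain E where E: "orthonormal_basis H0 E"
    using orthonormal_basis_exists[of "k ` (range a \<union> range b)"] kernel_in
    by (auto simp: assms(9) kernel_span_def)
  have TV: "Xab x \<in> H0" if "x \<in> H0" for x using T that by (auto simp: self_adjoint_on_def)
  have f: "f \<in> H0" using assms(10,13) by (auto simp: orth_in_def)
  have AV: "?A x \<in> H0" if "x \<in> H0" for x using TV[OF that] cfun.subspace_scale[OF sub] by blast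
  have A_le: "hnorm ip (?A x) \<le> opnorm_on ip H0 Xab * hnorm ip x" if "x \<in> H0" for x
    using hnorm_le_opnorm[OF T E H0 sub that] TV[OF that] H0 by (simp add: hnorm_scale subset_iff)
  have skew: "ip (?A x) y = - ip x (?A y)" if "x \<in> H0" "y \<in> H0" for x y
    using T that TV[of x] TV[of y] H0
    by (simp add: self_adjoint_on_def ip_scale ip_scale_right subset_iff)
  \<comment> \<open>The bound \<open>A_le\<close> at the unit vector \<open>f\<close> puts a norm
    below the operator norm.\<close>
  have nonneg: "0 \<le> opnorm_on ip H0 Xab"
    using A_le[OF f] AV[OF f] H0 \<open>hnorm ip f = 1\<close>
    by (auto intro: order_trans[OF hnorm_nonneg])
  have kb: "k (b j) \<in> H0" "k (b j) \<in> kernel_span k (range b)"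
    unfolding assms(9) kernel_span_def by (auto intro: cfun.span_base)
  have kH: "k (b j) \<in> H" and fH: "f \<in> H" using kb f H0 by auto
  define N where "N = hnorm ip (k (b j))"
  have N: "N = sqrt (Re (k (b j) (b j)))"
    unfolding N_def hnorm_def using reproducing[OF kH] by simp
  show "arcsin (cmod (f (b j)) / sqrt (Re (k (b j) (b j)))) \<le> opnorm_on ip H0 Xab"
  proof (cases "N = 0")
    \<comment> \<open>Division by zero yields 0, so the left-hand side is
      \<open>arcsin 0 = 0\<close>.\<close>
    case True
    then show ?thesis using nonneg by (simp flip: N)
  next
    case False
    then have Npos: "N > 0" using hnorm_nonneg[OF kH] by (simp add: N_def)
    obtain u where u: "cmod u = 1" "u * f (b j) = of_real (cmod (f (b j)))"
      using unimodular_rotation .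
    \<comment> \<open>The normalised kernel, with a phase chosen to make \<open>ip f h\<close> equal
      to |f(b_j)| / N. The phase is conjugated because \<open>ip\<close> is conjugate-linear in its
      second argument.\<close>
    define h where "h = cscale (cnj u / of_real N) (k (b j))"
    have hV: "h \<in> H0" unfolding h_def by (rule cfun.subspace_scale[OF sub kb(1)])
    have nh: "hnorm ip h = 1"
      unfolding h_def using kH u Npos by (simp add: hnorm_scale norm_divide N_def)
    have ip_h: "ip g h = u * g (b j) / of_real N" if "g \<in> H" for g
      unfolding h_def using that kH by (simp add: ip_scale_right reproducing)
    \<comment> \<open>The exponential carries \<open>Za\<close> onto \<open>Zb\<close>, so the
      endpoint of the curve is orthogonal to the kernel at \<open>b j\<close>, and thus to
      \<open>h\<close>.\<close>
    have "exp_op H ip ?A f \<in> Zb" using exp \<open>f \<in> Za\<close> by auto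
    then have "exp_op H ip ?A f \<in> H" "ip (exp_op H ip ?A f) (k (b j)) = 0"
      using assms(11) kb(2) H0 by (auto simp: orth_in_def)
    then have "ip (exp_op H ip ?A f) h = 0"
      by (simp add: h_def ip_scale_right kH)
    from arcsin_le_of_exp_orthogonal[OF H0 sub E AV A_le skew f nonneg \<open>hnorm ip f = 1\<close> hV nh this]
    show ?thesis by (simp add: ip_h[OF fH] u(2) flip: N)
  qed
qed

end
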